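(* For a complex parameter $x$, define $$I_{\beta'}(x):=\frac{1}{2^2}\,\frac{\pi\sqrt{m_1m_2}}{\hbar t}\;e\!\left(w_1,w_2,\frac{\hbar t}{2m_1},\frac{\hbar t}{2m_2}\right)\int_{0}^{\infty}e^{iz^2(m_1+m_2)/(2\hbar t)}\,\frac{\cos\left(xz/(t\hbar)\right)}{\cosh(\beta' z)}\,dz,$$ where $$e(w_1,w_2,t_1,t_2)=e^{-\left(w_1^2/(4it_1)+w_2^2/(4it_2)\right)}.$$ Then $$\int_{0}^{\infty}\int_{0}^{\infty}\cos(z_1w_1)\cos(z_2w_2)\,e^{-i\hbar z_1^2t/(2m_1)-i\hbar z_2^2t/(2m_2)}\left(\frac{\pi}{\beta'}\,\frac{\cosh\left(\frac{\pi z_1}{2\beta'}\right)\cosh\left(\frac{\pi z_2}{2\beta'}\right)}{\cosh\left(\frac{\pi z_1}{\beta'}\right)+\cosh\left(\frac{\pi z_2}{\beta'}\right)}\right)dz_1\,dz_2$$ $$=I_{\beta'}(w_1m_1+w_2m_2)+I_{\beta'}(w_1m_1-w_2m_2).$$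
   Context: Here $i$ is the imaginary unit, $\hbar$ is Planck's constant, $t$ is the time variable, and $m_1,m_2$ are the masses of the two particles in a two-particle Schrödinger equation with zero potential, $i\hbar\,\partial\psi/\partial t=-\frac{\hbar^2}{2m_1}\,\partial^2\psi/\partial x_1^2-\frac{\hbar^2}{2m_2}\,\partial^2\psi/\partial x_2^2$. The quantities $w_1,w_2$ and $\beta'$ are parameters. The function $I_{\beta'}(x)$ also depends on $w_1,w_2,t,m_1,m_2,\hbar$, which are held fixed.
   Formalization: The printed identity lacks a factor 1/i on the right (it fails at w1=w2=0); the formal theorem proves it with that factor, for real w1, w2, t≠0 and positive ħ, m1, m2, β', reading the double integral as an iterated improper integral. *)

theory Defs
  imports "HOL-Analysis.Analysis"
begin

definition gauss_phase :: "real \<Rightarrow> real \<Rightarrow> real \<Rightarrow> real \<Rightarrow> complex" where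
  "gauss_phase w1 w2 t1 t2 =
     exp (- ((of_real w1)\<^sup>2 / (4 * \<i> * of_real t1) + (of_real w2)\<^sup>2 / (4 * \<i> * of_real t2)))"

(* The Henstock-Kurzweil integral over {0..} is the improper integral from 0 to infinity.
   The prefactor is the one of the source. It comes from two Gaussian integrals
   int_0^oo cos (y u) exp (- \<i> s u^2) du = sqrt (pi / (\<i> s)) / 2 * exp (- y^2 / (4 \<i> s)),
   whose factor (1 / sqrt \<i>)^2 = 1 / \<i> the source drops; the double-integral identity is
   false without it (already for w1 = w2 = 0), so it has to be supplied there. *)
definition I_beta ::
  "real \<Rightarrow> real \<Rightarrow> real \<Rightarrow> real \<Rightarrow> real \<Rightarrow> real \<Rightarrow> real \<Rightarrow> complex \<Rightarrow> complex" where
  "I_beta hbar t m1 m2 w1 w2 \<beta> x =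
     1 / 2\<^sup>2 * of_real (pi * sqrt (m1 * m2) / (hbar * t)) *
     gauss_phase w1 w2 (hbar * t / (2 * m1)) (hbar * t / (2 * m2)) *
     integral {0..} (\<lambda>z::real.
       exp (\<i> * of_real (z\<^sup>2 * (m1 + m2) / (2 * hbar * t))) *
       (cos (x * of_real z / of_real (t * hbar)) / of_real (cosh (\<beta> * z))))"

definition cosh_kernel :: "real \<Rightarrow> real \<Rightarrow> real \<Rightarrow> real" where
  "cosh_kernel \<beta> z1 z2 =
     pi / \<beta> * (cosh (pi * z1 / (2 * \<beta>)) * cosh (pi * z2 / (2 * \<beta>)) /
       (cosh (pi * z1 / \<beta>) + cosh (pi * z2 / \<beta>)))"

definition schroedinger_integrand ::
  "real \<Rightarrow> real \<Rightarrow> real \<Rightarrow> real \<Rightarrow> real \<Rightarrow> real \<Rightarrow> real \<Rightarrow> real \<Rightarrow> real \<Rightarrow> complex" where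
  "schroedinger_integrand hbar t m1 m2 w1 w2 \<beta> z1 z2 =
     of_real (cos (z1 * w1) * cos (z2 * w2)) *
     exp (- \<i> * of_real (hbar * z1\<^sup>2 * t / (2 * m1)) - \<i> * of_real (hbar * z2\<^sup>2 * t / (2 * m2))) *
     of_real (cosh_kernel \<beta> z1 z2)"

end

theory Submission
  imports Defs
begin

text \<open>
  Since \<open>1 / cosh\<close> is its own cosine transform up to scaling, the kernel is
  \<open>\<integral>\<^sub>0\<^sup>\<infinity> cos (z1 u) cos (z2 u) / cosh (\<beta> u) du\<close>. Formally interchanging the integrals leaves, for each
  \<open>u\<close>, a product of two Gaussian integrals \<open>\<integral>\<^sub>0\<^sup>\<infinity> cos (z w) cos (z u) exp (- \<i> s z\<^sup>2) dz\<close>, whose values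
  combine to the right-hand side. The double integral is not absolutely convergent (the kernel does
  not decay along the diagonal), so one variable at a time is truncated to \<open>[0, R]\<close>: Fubini
  applies there, and because Fresnel integrals are bounded uniformly in their endpoints, \<open>R \<rightarrow> \<infinity>\<close>
  is a case of dominated convergence.

  The transform of \<open>1 / cosh\<close> follows from its expansion into exponentials, integrated term by
  term; the resulting partial fraction series is summed by the reflection formula for Digamma.
\<close>

section \<open>Fresnel integrals\<close>

definition chirp :: "real \<Rightarrow> real \<Rightarrow> complex" where
  "chirp s x = exp (- (\<i> * of_real (s * x\<^sup>2)))"

definition fresnel :: "real \<Rightarrow> real \<Rightarrow> complex" where
  "fresnel s x = (LBINT y=ereal 0..ereal x. chirp s y)"

definition fresnel_lim :: "real \<Rightarrow> complex" where
  "fresnel_lim s = Lim at_top (fresnel s)"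

lemma norm_chirp [simp]: "norm (chirp s x) = 1"
proof -
  have "chirp s x = exp (\<i> * of_real (- (s * x\<^sup>2)))" by (simp add: chirp_def)
  then show ?thesis by (simp only: norm_exp_i_times)
qed

lemma chirp_minus [simp]: "chirp s (- x) = chirp s x"
  by (simp add: chirp_def)

lemma continuous_on_chirp [continuous_intros]:
  "continuous_on A f \<Longrightarrow> continuous_on A (\<lambda>x. chirp s (f x))"
  unfolding chirp_def by (intro continuous_intros)

lemma chirp_has_vector_derivative:
  "(chirp s has_vector_derivative - (2 * \<i> * of_real (s * x)) * chirp s x) (at x within A)"
proof -
  have "((\<lambda>z. exp (- (\<i> * (of_real s * z\<^sup>2)))) has_field_derivative
          - (2 * \<i> * of_real (s * x)) * chirp s x) (at (of_real x))"
    by (auto intro!: derivative_eq_intros simp: chirp_def)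
  from has_vector_derivative_real_field[OF this, of A] show ?thesis
    by (simp add: chirp_def [abs_def])
qed

lemma fresnel_0 [simp]: "fresnel s 0 = 0"
  by (simp add: fresnel_def)

lemma fresnel_has_vector_derivative: "(fresnel s has_vector_derivative chirp s x) (at x within A)"
proof -
  let ?a = "min 0 x - 1" and ?b = "max 0 x + 1"
  have "((\<lambda>u. LBINT y=ereal 0..ereal u. chirp s y) has_vector_derivative chirp s x) (at x within {?a..?b})"
    by (intro interval_integral_FTC2 continuous_intros) auto
  then have "(fresnel s has_vector_derivative chirp s x) (at x within {?a<..<?b})"
    unfolding fresnel_def [abs_def] by (rule has_vector_derivative_within_subset) auto
  then have "(fresnel s has_vector_derivative chirp s x) (at x)"
    by (subst (asm) has_vector_derivative_within_open) auto
  then show ?thesis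
    by (rule has_vector_derivative_at_within)
qed

lemma fresnel_chain:
  assumes "(f has_real_derivative f') (at x within A)"
  shows "((\<lambda>x. fresnel s (f x)) has_vector_derivative of_real f' * chirp s (f x)) (at x within A)"
proof -
  have "(fresnel s \<circ> f has_vector_derivative f' *\<^sub>R chirp s (f x)) (at x within A)"
    by (rule vector_diff_chain_within[OF assms[unfolded has_real_derivative_iff_has_vector_derivative]
          fresnel_has_vector_derivative])
  then show ?thesis by (simp add: o_def scaleR_conv_of_real)
qed

lemma continuous_on_fresnel [continuous_intros]:
  assumes "continuous_on A f"
  shows "continuous_on A (\<lambda>x. fresnel s (f x))"
proof -
  have "continuous_on UNIV (fresnel s)"
    by (meson fresnel_has_vector_derivative continuous_on_vector_derivative)
  from continuous_on_compose2[OF this assms] show ?thesis by simp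
qed

lemma vector_derivative_zero_unique:
  fixes f :: "real \<Rightarrow> 'a::real_normed_vector"
  assumes "\<And>x. (f has_vector_derivative 0) (at x)"
  shows "f x = f y"
  by (rule has_derivative_zero_unique[of UNIV]) (use assms in \<open>auto simp: has_vector_derivative_def\<close>)

lemma fresnel_minus [simp]: "fresnel s (- x) = - fresnel s x"
proof -
  have "((\<lambda>x. fresnel s (- x) + fresnel s x) has_vector_derivative 0) (at x)" for x
    by (rule derivative_eq_intros fresnel_chain fresnel_has_vector_derivative refl | simp)+
  from vector_derivative_zero_unique[OF this, of x 0] show ?thesis
    by (simp add: eq_neg_iff_add_eq_0)
qed

lemma fresnel_scale:
  assumes "c > 0"
  shows "fresnel s (c * x) = of_real c * fresnel (s * c\<^sup>2) x"
proof -
  have "((\<lambda>x. fresnel s (c * x) - of_real c * fresnel (s * c\<^sup>2) x) has_vector_derivative 0) (at x)" for x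
    by (rule derivative_eq_intros fresnel_chain fresnel_has_vector_derivative refl
        | simp add: chirp_def power_mult_distrib algebra_simps)+
  from vector_derivative_zero_unique[OF this, of x 0] show ?thesis by simp
qed

lemma one_plus_of_real_square_neq_0: "1 + of_real y ^ 2 \<noteq> (0::complex)"
  by (metis of_real_1 of_real_add of_real_eq_0_iff of_real_power power_one sum_power2_eq_zero_iff zero_neq_one)

text \<open>Both sides have the same derivative in \<open>x\<close>; this is the classical trick evaluating the
  Gaussian integral without polar coordinates.\<close>
lemma fresnel_square:
  assumes "s \<noteq> 0"
  shows "(fresnel s x)\<^sup>2 =
    integral {0..1} (\<lambda>y. (1 - chirp s x * chirp s (x * y)) / of_real (1 + y\<^sup>2)) / (\<i> * of_real s)"
    (is "_ = integral _ (?f x) / _")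
proof -
  let ?fx = "\<lambda>x y. 2 * \<i> * of_real (s * x) * (chirp s x * chirp s (x * y))"
  have *: "((\<lambda>x. integral (cbox 0 1) (?f x)) has_vector_derivative integral (cbox 0 1) (?fx x))
          (at x within UNIV)" for x
  proof (rule leibniz_rule_vector_derivative)
    fix x y :: real
    have eq: "chirp s x * chirp s (x * y) = chirp (s * (1 + y\<^sup>2)) x" for x y
      by (simp add: chirp_def algebra_simps power_mult_distrib flip: exp_add)
    show "((\<lambda>x. ?f x y) has_vector_derivative ?fx x y) (at x within UNIV)"
      unfolding eq
      by (rule derivative_eq_intros chirp_has_vector_derivative refl
        | simp add: field_simps one_plus_of_real_square_neq_0)+
  next
    fix x :: real
    show "?f x integrable_on cbox 0 1"
      unfolding cbox_interval using one_plus_of_real_square_neq_0 by (intro integrable_continuous_interval continuous_intros) auto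
  qed (auto simp: case_prod_unfold intro!: continuous_intros)
  have sub: "of_real x * integral {0..1} (\<lambda>y. chirp s (x * y)) = fresnel s x" for x
  proof -
    have "((\<lambda>y. of_real x * chirp s (x * y)) has_integral fresnel s (x * 1) - fresnel s (x * 0)) {0..1}"
      by (intro fundamental_theorem_of_calculus fresnel_chain)
         (auto intro!: derivative_eq_intros)
    from integral_unique[OF this] show ?thesis by simp
  qed
  have fx: "integral {0..1} (?fx x) = 2 * \<i> * of_real s * chirp s x * fresnel s x" for x
    by (simp add: mult_ac flip: sub)
  have "((\<lambda>x. \<i> * of_real s * (fresnel s x)\<^sup>2 - integral {0..1} (?f x)) has_vector_derivative 0) (at x)" for x
    using *[of x] unfolding cbox_interval fx power2_eq_square
    by (auto intro!: derivative_eq_intros fresnel_has_vector_derivative)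
  from vector_derivative_zero_unique[OF this, of x 0] have
    "\<i> * of_real s * (fresnel s x)\<^sup>2 = integral {0..1} (?f x)"
    by (simp add: chirp_def)
  then show ?thesis using assms by (simp add: field_simps)
qed

lemma fresnel_bounded:
  assumes "s \<noteq> 0"
  obtains C where "\<And>x. norm (fresnel s x) \<le> C"
proof
  fix x
  have "norm ((1 - chirp s x * chirp s (x * y)) / of_real (1 + y\<^sup>2)) \<le> 2" for y
  proof -
    have "norm (1 - chirp s x * chirp s (x * y)) \<le> norm (1::complex) + norm (chirp s x * chirp s (x * y))"
      by (rule norm_triangle_ineq4)
    then have "norm (1 - chirp s x * chirp s (x * y)) \<le> 2" by (simp add: norm_mult)
    moreover have "1 \<le> norm (of_real (1 + y\<^sup>2) :: complex)" by (simp only: norm_of_real) simp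
    ultimately have "norm (1 - chirp s x * chirp s (x * y)) / norm (of_real (1 + y\<^sup>2) :: complex) \<le> 2 / 1"
      by (intro frac_le) auto
    then show ?thesis by (simp add: norm_divide)
  qed
  then have "norm (integral {0..1} (\<lambda>y. (1 - chirp s x * chirp s (x * y)) / of_real (1 + y\<^sup>2))) \<le> 2 * (1 - 0)"
    using one_plus_of_real_square_neq_0 by (intro integral_bound continuous_intros) auto
  then have "(norm (fresnel s x))\<^sup>2 \<le> 2 / \<bar>s\<bar>"
    by (simp add: fresnel_square[OF assms] norm_divide norm_mult divide_right_mono flip: norm_power)
  then show "norm (fresnel s x) \<le> sqrt (2 / \<bar>s\<bar>)"
    by (rule real_le_rsqrt)
qed

lemma fresnel_diff_bound:
  assumes "s \<noteq> 0" "0 < a" "a \<le> b"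
  shows "norm (fresnel s b - fresnel s a) \<le> 1 / (\<bar>s\<bar> * a)"
proof (cases "a = b")
  case False
  define Q where "Q x = fresnel s x - \<i> * chirp s x / (2 * of_real (s * x))" for x
  have Q: "(Q has_vector_derivative \<i> * chirp s x / (2 * of_real (s * x\<^sup>2))) (at x)" if "x > 0" for x
  proof -
    have "((\<lambda>x. fresnel s x - \<i> * (chirp s x * of_real (inverse (2 * (s * x))))) has_vector_derivative
      chirp s x - \<i> * (chirp s x * of_real (- 1 / (2 * s * x\<^sup>2)) +
        - (2 * \<i> * of_real (s * x)) * chirp s x * of_real (inverse (2 * (s * x))))) (at x)"
      using that assms
      by (intro has_vector_derivative_diff has_vector_derivative_mult_right has_vector_derivative_mult
           fresnel_has_vector_derivative chirp_has_vector_derivative has_vector_derivative_of_real)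
         (auto intro!: derivative_eq_intros simp: power2_eq_square divide_simps)
    then show ?thesis
      using that assms unfolding Q_def by (simp add: field_simps)
  qed
  have R: "((\<lambda>x. - (1 / (2 * \<bar>s\<bar> * x))) has_vector_derivative 1 / (2 * \<bar>s\<bar> * x\<^sup>2)) (at x)" if "x > 0" for x
    using that assms
    by (auto intro!: derivative_eq_intros simp: field_simps power2_eq_square
        simp flip: has_real_derivative_iff_has_vector_derivative)
  have "norm (Q b - Q a) \<le> - (1 / (2 * \<bar>s\<bar> * b)) - - (1 / (2 * \<bar>s\<bar> * a))"
  proof (rule differentiable_bound_general)
    show "continuous_on {a..b} Q"
      using assms by (intro continuous_at_imp_continuous_on ballI has_vector_derivative_continuous[OF Q]) auto
    show "continuous_on {a..b} (\<lambda>x. - (1 / (2 * \<bar>s\<bar> * x)))"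
      using assms by (intro continuous_at_imp_continuous_on ballI has_vector_derivative_continuous[OF R]) auto
    fix x assume "a < x" "x < b"
    with assms have "x > 0" by simp
    then show "(Q has_vector_derivative \<i> * chirp s x / (2 * of_real (s * x\<^sup>2))) (at x)"
      and "((\<lambda>x. - (1 / (2 * \<bar>s\<bar> * x))) has_vector_derivative 1 / (2 * \<bar>s\<bar> * x\<^sup>2)) (at x)"
      by (fact Q, fact R)
    show "norm (\<i> * chirp s x / (2 * of_real (s * x\<^sup>2))) \<le> 1 / (2 * \<bar>s\<bar> * x\<^sup>2)"
      by (simp add: norm_mult norm_divide norm_power)
  qed (use assms False in auto)
  then have "norm (Q b - Q a) \<le> 1 / (2 * (\<bar>s\<bar> * a)) - 1 / (2 * (\<bar>s\<bar> * b))"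
    by (simp add: mult.assoc)
  moreover have "fresnel s b - fresnel s a =
      (Q b - Q a) + (\<i> * chirp s b / (2 * of_real (s * b)) - \<i> * chirp s a / (2 * of_real (s * a)))"
    by (simp add: Q_def)
  then have "norm (fresnel s b - fresnel s a) \<le> norm (Q b - Q a) +
      (norm (\<i> * chirp s b / (2 * of_real (s * b))) + norm (\<i> * chirp s a / (2 * of_real (s * a))))"
    by (metis norm_triangle_ineq norm_triangle_ineq4 order_trans add_left_mono)
  then have "norm (fresnel s b - fresnel s a) \<le> norm (Q b - Q a) + (1 / (2 * (\<bar>s\<bar> * b)) + 1 / (2 * (\<bar>s\<bar> * a)))"
    using assms by (simp add: norm_mult norm_divide)
  ultimately have "norm (fresnel s b - fresnel s a) \<le> 1 / (2 * (\<bar>s\<bar> * a)) + 1 / (2 * (\<bar>s\<bar> * a))"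
    by linarith
  also have "\<dots> = 1 / (\<bar>s\<bar> * a)"
    by (simp flip: add_divide_distrib)
  finally show ?thesis .
qed (use assms in auto)

lemma tendsto_fresnel_lim:
  assumes "s \<noteq> 0"
  shows "(fresnel s \<longlongrightarrow> fresnel_lim s) at_top"
proof -
  have "cauchy_filter (filtermap (fresnel s) at_top)"
    unfolding cauchy_filter_metric_filtermap
  proof safe
    fix e :: real assume e: "e > 0"
    have *: "dist (fresnel s x) (fresnel s y) < e" if "2 / (\<bar>s\<bar> * e) \<le> x" "x \<le> y" for x y
    proof -
      have "0 < 2 / (\<bar>s\<bar> * e)" using assms e by simp
      with that have x: "0 < x" by linarith
      then have "norm (fresnel s y - fresnel s x) \<le> 1 / (\<bar>s\<bar> * x)"
        using that assms by (intro fresnel_diff_bound)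
      also have "\<dots> < e"
        using that x e assms by (simp add: field_simps)
      finally show ?thesis by (simp add: dist_norm norm_minus_commute)
    qed
    show "\<exists>P. eventually P at_top \<and> (\<forall>x y. P x \<and> P y \<longrightarrow> dist (fresnel s x) (fresnel s y) < e)"
    proof (intro exI conjI allI impI)
      show "\<forall>\<^sub>F x in at_top. 2 / (\<bar>s\<bar> * e) \<le> x" by (rule eventually_ge_at_top)
      fix x y assume "2 / (\<bar>s\<bar> * e) \<le> x \<and> 2 / (\<bar>s\<bar> * e) \<le> y"
      then show "dist (fresnel s x) (fresnel s y) < e"
        using *[of x y] *[of y x] by (cases "x \<le> y") (auto simp: dist_commute)
    qed
  qed
  then obtain l where l: "(fresnel s \<longlongrightarrow> l) at_top"
    unfolding filterlim_def using cauchy_filter_complete_converges[of _ UNIV] complete_UNIV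
    by (metis filtermap_bot_iff trivial_limit_at_top_linorder principal_UNIV top_greatest)
  moreover have "fresnel_lim s = l"
    unfolding fresnel_lim_def by (rule tendsto_Lim[OF _ l]) simp
  ultimately show ?thesis by simp
qed

text \<open>The oscillating part of the integral in \<open>fresnel_square\<close> is integrated by parts, which
  gains a factor \<open>1 / x\<close>.\<close>
lemma fresnel_lim_square:
  assumes "s \<noteq> 0"
  shows "(fresnel_lim s)\<^sup>2 = of_real pi / (4 * \<i> * of_real s)"
proof -
  obtain C where C: "norm (fresnel s x) \<le> C" for x
    using fresnel_bounded[OF assms] by blast
  have one_plus_of_real_square_neq_0': "1 + y ^ 2 \<noteq> 0" for y :: real
    by (smt (verit) zero_le_power2)
  let ?h = "\<lambda>x y. 2 * of_real y * fresnel s (x * y) / of_real (x * (1 + y\<^sup>2)\<^sup>2)"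
  let ?J = "\<lambda>x. integral {0..1} (\<lambda>y. chirp s (x * y) / of_real (1 + y\<^sup>2))"
  have J: "norm (?J x) \<le> 3 * C / x" if "x > 0" for x
  proof -
    have "((\<lambda>y. fresnel s (x * y) / of_real (x * (1 + y\<^sup>2))) has_vector_derivative
        chirp s (x * y) / of_real (1 + y\<^sup>2) - ?h x y) (at y within {0..1})" for y
    proof -
      have "((\<lambda>y. fresnel s (x * y) * of_real (inverse (x * (1 + y\<^sup>2)))) has_vector_derivative
        fresnel s (x * y) * of_real (- (2 * y) / (x * (1 + y\<^sup>2)\<^sup>2)) +
          of_real x * chirp s (x * y) * of_real (inverse (x * (1 + y\<^sup>2)))) (at y within {0..1})"
        using that one_plus_of_real_square_neq_0'[of y]
        by (intro has_vector_derivative_mult fresnel_chain has_vector_derivative_of_real)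
           (auto intro!: derivative_eq_intros simp: power2_eq_square divide_simps)
      moreover have "P * of_real (- (2 * y) / (x * Y\<^sup>2)) + of_real x * c * of_real (inverse (x * Y)) =
          c / of_real Y - 2 * of_real y * P / of_real (x * Y\<^sup>2)" if "Y \<noteq> 0" for P c :: complex and Y
        using that \<open>x > 0\<close> by (simp add: field_simps)
      from this[OF one_plus_of_real_square_neq_0'] have "fresnel s (x * y) * of_real (- (2 * y) / (x * (1 + y\<^sup>2)\<^sup>2)) +
          of_real x * chirp s (x * y) * of_real (inverse (x * (1 + y\<^sup>2))) =
          chirp s (x * y) / of_real (1 + y\<^sup>2) - ?h x y" .
      moreover have "(\<lambda>y. fresnel s (x * y) * of_real (inverse (x * (1 + y\<^sup>2)))) =
          (\<lambda>y. fresnel s (x * y) / of_real (x * (1 + y\<^sup>2)))"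
        by (simp only: of_real_inverse divide_inverse)
      ultimately show ?thesis by simp
    qed
    then have "((\<lambda>y. chirp s (x * y) / of_real (1 + y\<^sup>2) - ?h x y) has_integral
      fresnel s (x * 1) / of_real (x * (1 + 1\<^sup>2)) - fresnel s (x * 0) / of_real (x * (1 + 0\<^sup>2))) {0..1}"
      by (intro fundamental_theorem_of_calculus) auto
    moreover have h: "(?h x) integrable_on {0..1}"
      using that one_plus_of_real_square_neq_0 by (intro integrable_continuous_interval continuous_intros) auto
    ultimately have "((\<lambda>y. (chirp s (x * y) / of_real (1 + y\<^sup>2) - ?h x y) + ?h x y) has_integral
      fresnel s (x * 1) / of_real (x * (1 + 1\<^sup>2)) - fresnel s (x * 0) / of_real (x * (1 + 0\<^sup>2)) +
      integral {0..1} (?h x)) {0..1}"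
      by (intro has_integral_add) (auto simp: integrable_integral)
    then have "?J x = fresnel s x / of_real (2 * x) + integral {0..1} (?h x)"
      by (simp add: integral_unique mult.commute)
    moreover have "norm (fresnel s x / of_real (2 * x)) \<le> C / (2 * x)"
      using that C[of x] by (simp add: norm_divide divide_right_mono)
    moreover have "norm (integral {0..1} (?h x)) \<le> (2 * C / x) * (1 - 0)"
    proof (rule integral_bound)
      show "continuous_on {0..1} (?h x)"
        using that one_plus_of_real_square_neq_0 by (intro continuous_intros) auto
      fix y :: real assume y: "y \<in> {0..1}"
      have "norm (?h x y) = (2 * y * norm (fresnel s (x * y))) / (x * (1 + y\<^sup>2)\<^sup>2)"
        using that y by (simp only: norm_mult norm_divide norm_of_real) simp
      also have "\<dots> \<le> (2 * 1 * C) / (x * 1)"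
        using y that C[of "x * y"] C[of 0]
        by (intro frac_le mult_mono mult_left_mono) (auto intro: order_trans[OF norm_ge_zero])
      finally show "norm (?h x y) \<le> 2 * C / x" by simp
    qed simp
    ultimately have "norm (?J x) \<le> C / (2 * x) + 2 * C / x"
      by (simp only: norm_triangle_mono mult_1_right diff_0_right)
    also have "\<dots> \<le> 3 * C / x"
      using that C[of 0] by (simp add: field_simps)
    finally show ?thesis .
  qed
  have "((\<lambda>x::real. 3 * C / x) \<longlongrightarrow> 0) at_top"
    by real_asymp
  then have "(?J \<longlongrightarrow> 0) at_top"
    by (rule Lim_null_comparison[rotated]) (intro eventually_mono[OF eventually_gt_at_top[of 0]] J)
  then have J0: "((\<lambda>x. chirp s x * ?J x) \<longlongrightarrow> 0) at_top"
    by (rule tendsto_norm_zero_cancel[OF tendsto_cong[THEN iffD1, OF always_eventually], rotated, OF tendsto_norm_zero])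
       (simp add: norm_mult)
  have arctan: "integral {0..1} (\<lambda>y. 1 / of_real (1 + y\<^sup>2) :: complex) = of_real (pi / 4)"
  proof -
    have "((\<lambda>y. 1 / (1 + y\<^sup>2)) has_integral arctan 1 - arctan 0) {0..1::real}"
      by (intro fundamental_theorem_of_calculus)
         (auto intro!: derivative_eq_intros simp: field_simps simp flip: has_real_derivative_iff_has_vector_derivative)
    from integral_unique[OF has_integral_of_real[OF this, where 'b = complex]] show ?thesis
      by (simp add: arctan_one)
  qed
  have "(fresnel s x)\<^sup>2 = (of_real (pi / 4) - chirp s x * ?J x) / (\<i> * of_real s)" for x
  proof -
    have "integral {0..1} (\<lambda>y. (1 - chirp s x * chirp s (x * y)) / of_real (1 + y\<^sup>2)) =
      integral {0..1} (\<lambda>y. 1 / of_real (1 + y\<^sup>2) - chirp s x * (chirp s (x * y) / of_real (1 + y\<^sup>2)))"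
      by (simp add: diff_divide_distrib)
    also have "\<dots> = of_real (pi / 4) - chirp s x * ?J x"
      unfolding arctan[symmetric] integral_mult_right[symmetric] using one_plus_of_real_square_neq_0
      by (intro integral_diff integrable_continuous_interval continuous_intros) auto
    finally show ?thesis by (simp add: fresnel_square[OF assms])
  qed
  moreover have "((\<lambda>x. (of_real (pi / 4) - chirp s x * ?J x) / (\<i> * of_real s)) \<longlongrightarrow>
      (of_real (pi / 4) - 0) / (\<i> * of_real s)) at_top"
    using assms by (intro tendsto_intros J0) auto
  ultimately have "((\<lambda>x. (fresnel s x)\<^sup>2) \<longlongrightarrow> of_real (pi / 4) / (\<i> * of_real s)) at_top"
    by simp
  moreover have "((\<lambda>x. (fresnel s x)\<^sup>2) \<longlongrightarrow> (fresnel_lim s)\<^sup>2) at_top"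
    by (intro tendsto_intros tendsto_fresnel_lim assms)
  ultimately have "(fresnel_lim s)\<^sup>2 = of_real (pi / 4) / (\<i> * of_real s)"
    using tendsto_unique trivial_limit_at_top_linorder by blast
  then show ?thesis by (simp add: field_simps)
qed

lemma fresnel_lim_scale:
  assumes "s \<noteq> 0" "c > 0"
  shows "fresnel_lim s = of_real c * fresnel_lim (s * c\<^sup>2)"
proof -
  have "((\<lambda>x. fresnel s (c * x)) \<longlongrightarrow> fresnel_lim s) at_top"
    using assms by (intro filterlim_compose[OF tendsto_fresnel_lim] filterlim_tendsto_pos_mult_at_top[OF tendsto_const]
       filterlim_ident) auto
  moreover have "((\<lambda>x. fresnel s (c * x)) \<longlongrightarrow> of_real c * fresnel_lim (s * c\<^sup>2)) at_top"
    unfolding fresnel_scale[OF assms(2)] using assms by (intro tendsto_intros tendsto_fresnel_lim) auto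
  ultimately show ?thesis
    using tendsto_unique trivial_limit_at_top_linorder by blast
qed

section \<open>The cosine transform of the hyperbolic secant\<close>

lemma Digamma_reflection_complex:
  fixes z :: complex
  assumes "z \<notin> \<int>"
  shows "Digamma (1 - z) - Digamma z = of_real pi * cot (of_real pi * z)"
proof -
  have z: "z \<notin> \<int>\<^sub>\<le>\<^sub>0" "1 - z \<notin> \<int>\<^sub>\<le>\<^sub>0"
    using assms nonpos_Ints_Int Ints_diff[OF Ints_1, of "1 - z"] by auto
  have sin: "sin (of_real pi * z) \<noteq> 0"
    using assms by (auto simp: sin_eq_0 mult.commute)
  have "((\<lambda>z. Gamma z * Gamma (1 - z)) has_field_derivative
      Gamma z * Gamma (1 - z) * (Digamma z - Digamma (1 - z))) (at z)"
    using z by (auto intro!: derivative_eq_intros simp: algebra_simps)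
  moreover have "((\<lambda>z. of_real pi / sin (of_real pi * z)) has_field_derivative
      - (of_real pi)\<^sup>2 * cos (of_real pi * z) / (sin (of_real pi * z))\<^sup>2) (at z)"
    using sin by (auto intro!: derivative_eq_intros simp: power2_eq_square)
  ultimately have "Gamma z * Gamma (1 - z) * (Digamma z - Digamma (1 - z)) =
      - (of_real pi)\<^sup>2 * cos (of_real pi * z) / (sin (of_real pi * z))\<^sup>2"
    unfolding Gamma_reflection_complex by (rule DERIV_unique)
  then have "of_real pi / sin (of_real pi * z) * (Digamma z - Digamma (1 - z)) =
      of_real pi / sin (of_real pi * z) * - (of_real pi * cot (of_real pi * z))"
    by (simp add: Gamma_reflection_complex cot_def power2_eq_square)
  then have "Digamma z - Digamma (1 - z) = - (of_real pi * cot (of_real pi * z))"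
    using sin by (subst (asm) mult_left_cancel) auto
  then show ?thesis by (simp add: algebra_simps)
qed

lemma sech_partial_fractions:
  fixes x :: real
  shows "(\<lambda>k. 2 * ((4 * real k + 1) / ((4 * real k + 1)\<^sup>2 + x\<^sup>2) - (4 * real k + 3) / ((4 * real k + 3)\<^sup>2 + x\<^sup>2)))
    sums (pi / (2 * cosh (pi * x / 2)))"
proof -
  define z :: complex where "z = (1 + \<i> * of_real x) / 4"
  have re: "Re z = 1 / 4" by (simp add: z_def)
  have zn: "w \<notin> \<int>" if "Re w = 1 / 4" for w
  proof
    assume "w \<in> \<int>"
    then obtain n where "w = of_int n" by (elim Ints_cases)
    with that have "4 * real_of_int n = 1" by simp
    then have "4 * n = 1" by linarith
    then show False by presburger
  qed
  have D: "(\<lambda>n. inverse (w + of_nat n) - inverse (1 - w + of_nat n)) sums (of_real pi * cot (of_real pi * w))"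
    if w: "Re w = 1 / 4" for w
  proof -
    have "w \<noteq> 0" "1 - w \<noteq> 0" using w by auto
    from tendsto_diff[OF Digamma_LIMSEQ[OF this(2)] Digamma_LIMSEQ[OF this(1)]]
    show ?thesis
      by (simp add: sums_def sum_subtractf Digamma_reflection_complex[OF zn[OF w]])
  qed
  have "(\<lambda>n. (1/4) * ((inverse (z + of_nat n) - inverse (1 - z + of_nat n)) +
      (inverse (cnj z + of_nat n) - inverse (1 - cnj z + of_nat n)))) sums
      ((1/4) * (of_real pi * cot (of_real pi * z) + of_real pi * cot (of_real pi * cnj z)))"
    by (intro sums_mult sums_add D) (auto simp: re)
  moreover have "(1/4) * ((inverse (z + of_nat n) - inverse (1 - z + of_nat n)) +
      (inverse (cnj z + of_nat n) - inverse (1 - cnj z + of_nat n))) =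
     of_real (2 * ((4 * real n + 1) / ((4 * real n + 1)\<^sup>2 + x\<^sup>2) - (4 * real n + 3) / ((4 * real n + 3)\<^sup>2 + x\<^sup>2)))" for n
  proof -
    have eq: "inverse (w + of_nat n) + inverse (cnj w + of_nat n) =
       of_real (2 * (Re w + n) / ((Re w + n)\<^sup>2 + (Im w)\<^sup>2))" for w
    proof -
      have "inverse v + inverse (cnj v) = of_real (2 * Re v / ((Re v)\<^sup>2 + (Im v)\<^sup>2))" for v
        by (simp add: complex_eq_iff)
      from this[of "w + of_nat n"] show ?thesis by simp
    qed
    have "(1/4) * ((inverse (z + of_nat n) - inverse (1 - z + of_nat n)) +
      (inverse (cnj z + of_nat n) - inverse (1 - cnj z + of_nat n))) =
      (1/4) * ((inverse (z + of_nat n) + inverse (cnj z + of_nat n)) -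
        (inverse (1 - z + of_nat n) + inverse (cnj (1 - z) + of_nat n)))"
      by (simp add: algebra_simps)
    also have "\<dots> = of_real ((1/4) * (2 * (1/4 + n) / ((1/4 + n)\<^sup>2 + (x/4)\<^sup>2) - 2 * (3/4 + n) / ((3/4 + n)\<^sup>2 + (x/4)\<^sup>2)))"
      unfolding eq by (simp add: z_def)
    also have "(1/4) * (2 * (1/4 + n) / ((1/4 + n)\<^sup>2 + (x/4)\<^sup>2) - 2 * (3/4 + n) / ((3/4 + n)\<^sup>2 + (x/4)\<^sup>2)) =
      2 * ((4 * real n + 1) / ((4 * real n + 1)\<^sup>2 + x\<^sup>2) - (4 * real n + 3) / ((4 * real n + 3)\<^sup>2 + x\<^sup>2))"
    proof -
      have e: "2 * (a / 4) / ((a / 4)\<^sup>2 + (x/4)\<^sup>2) = 8 * (a / (a\<^sup>2 + x\<^sup>2))" for a :: real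
        by (simp add: power_divide flip: add_divide_distrib)
      have "1/4 + real n = (4 * real n + 1) / 4" "3/4 + real n = (4 * real n + 3) / 4" by simp_all
      then show ?thesis by (simp only: e) simp
    qed
    finally show ?thesis .
  qed
  moreover have "(1/4) * (of_real pi * cot (of_real pi * z) + of_real pi * cot (of_real pi * cnj z)) =
      of_real (pi / (2 * cosh (pi * x / 2)))"
  proof -
    define a where "a = of_real pi * z"
    define b where "b = of_real pi * cnj z"
    have ab: "a + b = of_real (pi / 2)" "a - b = \<i> * of_real (pi * x / 2)"
      by (simp_all add: a_def b_def z_def field_simps)
    have "sin (of_real pi * w) \<noteq> 0" if "w \<notin> \<int>" for w :: complex
      using that by (auto simp: sin_eq_0 mult.commute)
    from this[of z] this[of "cnj z"] have sin0: "sin a \<noteq> 0" "sin b \<noteq> 0"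
      using zn[of z] zn[of "cnj z"] re by (simp_all add: a_def b_def)
    have "sin a * sin b = (cos (a - b) - cos (a + b)) / 2"
      by (simp add: cos_diff cos_add)
    also have "\<dots> = of_real (cosh (pi * x / 2)) / 2"
      unfolding ab cos_of_real cosh_conv_cos[symmetric]
      by (simp add: cosh_field_def exp_minus flip: exp_of_real)
    finally have ss: "sin a * sin b = of_real (cosh (pi * x / 2)) / 2" .
    have "cot a + cot b = sin (a + b) / (sin a * sin b)"
      using sin0 by (simp add: cot_def sin_add field_simps)
    also have "\<dots> = of_real (2 / cosh (pi * x / 2))"
      unfolding ab ss sin_of_real by simp
    finally have "of_real (pi / 4) * (cot a + cot b) = of_real (pi / 4 * (2 / cosh (pi * x / 2)))"
      by (simp only: of_real_mult)
    then show ?thesis by (simp add: a_def b_def algebra_simps)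
  qed
  ultimately show ?thesis by (simp only: sums_of_real_iff)
qed

lemma has_integral_atLeastI:
  fixes f :: "real \<Rightarrow> 'a::banach"
  assumes int: "\<And>R. R \<ge> a \<Longrightarrow> (f has_integral F R) {a..R}" and lim: "(F \<longlongrightarrow> l) at_top"
  shows "(f has_integral l) {a..}"
  unfolding has_integral_alt'
proof safe
  have res: "((\<lambda>x. if x \<in> {a..} then f x else 0) has_integral (if a \<le> d then F d else 0)) {c..d}"
    if "c \<le> a" for c d
  proof -
    have *: "{a..} \<inter> {c..d} = {a..d}" using that by auto
    have "(f has_integral (if a \<le> d then F d else 0)) {a..d}"
      using int[of d] by (cases "a \<le> d") auto
    then show ?thesis by (subst has_integral_restrict_Int) (simp only: *)
  qed
  fix c d :: real
  have "(\<lambda>x. if x \<in> {a..} then f x else 0) integrable_on {min a c..d}"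
    using res[of "min a c" d] by (auto simp: integrable_on_def)
  then show "(\<lambda>x. if x \<in> {a..} then f x else 0) integrable_on cbox c d"
    unfolding cbox_interval by (rule integrable_on_subinterval) auto
  fix e :: real assume e: "e > 0"
  obtain N where N: "\<And>R. R \<ge> N \<Longrightarrow> dist (F R) l < e"
    using tendstoD[OF lim e] by (auto simp: eventually_at_top_linorder)
  let ?B = "\<bar>a\<bar> + \<bar>N\<bar> + 1"
  show "\<exists>B>0. \<forall>c d. ball 0 B \<subseteq> cbox c d \<longrightarrow>
      norm (integral (cbox c d) (\<lambda>x. if x \<in> {a..} then f x else 0) - l) < e"
  proof (intro exI[of _ ?B] conjI allI impI)
    fix c d :: real assume sub: "ball 0 ?B \<subseteq> cbox c d"
    have "- (\<bar>a\<bar> + \<bar>N\<bar>) \<in> ball 0 ?B" "\<bar>a\<bar> + \<bar>N\<bar> \<in> ball 0 ?B" by (auto simp: dist_real_def)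
    with sub have "- (\<bar>a\<bar> + \<bar>N\<bar>) \<in> cbox c d" "\<bar>a\<bar> + \<bar>N\<bar> \<in> cbox c d" by blast+
    then have "c \<le> a" "a \<le> d" "N \<le> d" by auto
    then show "norm (integral (cbox c d) (\<lambda>x. if x \<in> {a..} then f x else 0) - l) < e"
      using integral_unique[OF res[of c d]] N[of d] by (simp add: dist_norm)
  qed simp
qed

lemma exp_cos_has_integral:
  fixes c x :: real
  assumes "c > 0"
  shows "((\<lambda>u. exp (- c * u) * cos (x * u)) has_integral c / (c\<^sup>2 + x\<^sup>2)) {0..}"
proof (rule has_integral_atLeastI)
  let ?F = "\<lambda>u. exp (- c * u) * (x * sin (x * u) - c * cos (x * u)) / (c\<^sup>2 + x\<^sup>2)"
  have nz: "c\<^sup>2 + x\<^sup>2 > 0" using assms by (simp add: add_pos_nonneg)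
  show "((\<lambda>u. exp (- c * u) * cos (x * u)) has_integral ?F R - ?F 0) {0..R}" if "R \<ge> 0" for R
  proof (rule fundamental_theorem_of_calculus[OF that])
    fix u
    have "(?F has_real_derivative ((- c * exp (- c * u)) * (x * sin (x * u) - c * cos (x * u)) +
      exp (- c * u) * (x * (x * cos (x * u)) + c * (x * sin (x * u)))) / (c\<^sup>2 + x\<^sup>2)) (at u within {0..R})"
      using nz by (auto intro!: derivative_eq_intros)
    also have "((- c * exp (- c * u)) * (x * sin (x * u) - c * cos (x * u)) +
      exp (- c * u) * (x * (x * cos (x * u)) + c * (x * sin (x * u)))) / (c\<^sup>2 + x\<^sup>2) = exp (- c * u) * cos (x * u)"
    proof -
      have "(- c * exp (- c * u)) * (x * sin (x * u) - c * cos (x * u)) +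
          exp (- c * u) * (x * (x * cos (x * u)) + c * (x * sin (x * u))) =
        exp (- c * u) * cos (x * u) * (c\<^sup>2 + x\<^sup>2)"
        by (simp add: algebra_simps power2_eq_square)
      with nz show ?thesis by (simp only: nonzero_mult_div_cancel_right[OF less_imp_neq[OF nz, symmetric]])
    qed
    finally show "(?F has_vector_derivative exp (- c * u) * cos (x * u)) (at u within {0..R})"
      by (simp add: has_real_derivative_iff_has_vector_derivative)
  qed
  have "((\<lambda>u. exp (- c * u)) \<longlongrightarrow> 0) at_top"
    using assms by real_asymp
  moreover have "norm (x * sin (x * u) - c * cos (x * u)) \<le> \<bar>x\<bar> + \<bar>c\<bar>" for u
  proof -
    have "norm (x * sin (x * u) - c * cos (x * u)) \<le> \<bar>x\<bar> * \<bar>sin (x * u)\<bar> + \<bar>c\<bar> * \<bar>cos (x * u)\<bar>"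
      using abs_triangle_ineq4[of "x * sin (x * u)" "c * cos (x * u)"] by (simp add: abs_mult)
    also have "\<dots> \<le> \<bar>x\<bar> * 1 + \<bar>c\<bar> * 1" by (intro add_mono mult_left_mono) auto
    finally show ?thesis by simp
  qed
  then have "Bfun (\<lambda>u. x * sin (x * u) - c * cos (x * u)) at_top"
    by (intro BfunI[of _ "\<bar>x\<bar> + \<bar>c\<bar>"] always_eventually) auto
  ultimately have "((\<lambda>u. exp (- c * u) * (x * sin (x * u) - c * cos (x * u))) \<longlongrightarrow> 0) at_top"
    unfolding tendsto_Zfun_iff diff_0_right by (rule bounded_bilinear.Zfun_prod_Bfun[OF bounded_bilinear_mult])
  from tendsto_divide_zero[OF this]
  have "((\<lambda>R. ?F R) \<longlongrightarrow> 0) at_top" .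
  then have "((\<lambda>R. ?F R - ?F 0) \<longlongrightarrow> 0 - ?F 0) at_top" by (intro tendsto_intros)
  then show "((\<lambda>R. ?F R - ?F 0) \<longlongrightarrow> c / (c\<^sup>2 + x\<^sup>2)) at_top" by simp
qed

lemma one_over_cosh_le: "1 / cosh (u::real) \<le> 2 * exp (- u)"
proof -
  have "1 / cosh u = 2 / (exp u + exp (- u))" by (simp add: cosh_field_def)
  also have "\<dots> \<le> 2 / exp u" by (intro divide_left_mono) (auto simp: add_pos_pos)
  finally show ?thesis by (simp add: exp_minus field_simps)
qed

text \<open>The alternating expansion of \<open>1 / cosh\<close> is taken two terms at a time, so that its partial sums
  lie between \<open>0\<close> and \<open>1 / cosh\<close>.\<close>
lemma exp_diff_sums_over_cosh:
  "(\<Sum>k<n. 2 * (exp (- (4 * real k + 1) * u) - exp (- (4 * real k + 3) * u))) = (1 - exp (- (4 * real n * u))) / cosh u"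
proof (induction n)
  case (Suc n)
  define q E where "q = exp (- u)" and "E = exp (- (4 * real n * u))"
  have E: "exp (- (4 * real n + 1) * u) = E * q" "exp (- (4 * real n + 3) * u) = E * q ^ 3"
    "exp (- (4 * real (Suc n) * u)) = E * q ^ 4"
    by (simp_all add: q_def E_def algebra_simps flip: exp_add exp_of_nat_mult)
  have q: "exp u * q = 1" by (simp add: q_def flip: exp_add)
  have "2 * cosh u = exp u + q" by (simp add: cosh_field_def q_def)
  then have "2 * cosh u * (E * q - E * q ^ 3) = E * (exp u * q) * (1 - q\<^sup>2) + E * (q\<^sup>2 - q ^ 4)"
    by (simp only:) (simp add: algebra_simps power2_eq_square power3_eq_cube power4_eq_xxxx)
  also have "\<dots> = E - E * q ^ 4" by (simp only: q) (simp add: algebra_simps)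
  finally have "2 * (E * q - E * q ^ 3) = (E - E * q ^ 4) / cosh u"
    by (simp add: eq_divide_eq mult_ac)
  then show ?case
    by (simp only: sum.lessThan_Suc Suc.IH E flip: E_def add_divide_distrib) simp
qed simp

lemma sech_cos_transform:
  assumes "\<beta> > 0"
  shows "((\<lambda>u. cos (x * u) / cosh (\<beta> * u)) has_integral pi / (2 * \<beta> * cosh (pi * x / (2 * \<beta>)))) {0..}"
proof -
  let ?f = "\<lambda>k u. 2 * (exp (- (4 * real k + 1) * (\<beta> * u)) - exp (- (4 * real k + 3) * (\<beta> * u))) * cos (x * u)"
  let ?a = "\<lambda>k. 2 * ((4 * real k + 1) / ((4 * real k + 1)\<^sup>2 + (x / \<beta>)\<^sup>2) -
    (4 * real k + 3) / ((4 * real k + 3)\<^sup>2 + (x / \<beta>)\<^sup>2))"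
  have exp_cos: "((\<lambda>u. exp (- c * (\<beta> * u)) * cos (x * u)) has_integral 1 / \<beta> * (c / (c\<^sup>2 + (x / \<beta>)\<^sup>2))) {0..}"
    if "c > 0" for c
  proof -
    have "\<beta> * c / ((\<beta> * c)\<^sup>2 + x\<^sup>2) = \<beta> * c / (\<beta>\<^sup>2 * (c\<^sup>2 + (x / \<beta>)\<^sup>2))"
      using assms by (simp add: power_mult_distrib power_divide distrib_left)
    also have "\<dots> = 1 / \<beta> * (c / (c\<^sup>2 + (x / \<beta>)\<^sup>2))"
      using assms by (simp add: power2_eq_square)
    finally show ?thesis
      using exp_cos_has_integral[of "\<beta> * c" x] assms that by (simp add: mult_ac)
  qed
  have int: "((\<lambda>u. \<Sum>k<n. ?f k u) has_integral 1 / \<beta> * (\<Sum>k<n. ?a k)) {0..}" for n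
  proof -
    have "((\<lambda>u. \<Sum>k<n. 2 * (exp (- (4 * real k + 1) * (\<beta> * u)) * cos (x * u) -
        exp (- (4 * real k + 3) * (\<beta> * u)) * cos (x * u))) has_integral
      (\<Sum>k<n. 2 * (1 / \<beta> * ((4 * real k + 1) / ((4 * real k + 1)\<^sup>2 + (x / \<beta>)\<^sup>2)) -
        1 / \<beta> * ((4 * real k + 3) / ((4 * real k + 3)\<^sup>2 + (x / \<beta>)\<^sup>2))))) {0..}"
      by (intro has_integral_sum has_integral_mult_right has_integral_diff exp_cos) auto
    then show ?thesis
      by (simp add: sum_distrib_left algebra_simps)
  qed
  have eq: "(\<Sum>k<n. ?f k u) = (1 - exp (- (4 * real n * (\<beta> * u)))) / cosh (\<beta> * u) * cos (x * u)" for n u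
    unfolding exp_diff_sums_over_cosh[symmetric] sum_distrib_right ..
  have conv: "(\<lambda>n. \<Sum>k<n. ?f k u) \<longlonglongrightarrow> (if u = 0 then 0 else cos (x * u) / cosh (\<beta> * u))" if "u \<in> {0..}" for u
  proof (cases "u = 0")
    case False
    have "(\<lambda>n. exp (- (4 * real n * v))) \<longlonglongrightarrow> 0" if "v > 0" for v
      using that by real_asymp
    from this[of "\<beta> * u"] False that assms have "(\<lambda>n. exp (- (4 * real n * (\<beta> * u)))) \<longlonglongrightarrow> 0" by simp
    then have "(\<lambda>n. (1 - exp (- (4 * real n * (\<beta> * u)))) / cosh (\<beta> * u) * cos (x * u)) \<longlonglongrightarrow>
        (1 - 0) / cosh (\<beta> * u) * cos (x * u)"
      by (intro tendsto_intros) auto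
    with False show ?thesis unfolding eq by simp
  qed simp
  have le: "norm (\<Sum>k<n. ?f k u) \<le> 2 * exp (- \<beta> * u)" if "u \<in> {0..}" for u n
  proof -
    have "norm (\<Sum>k<n. ?f k u) = (1 - exp (- (4 * real n * (\<beta> * u)))) / cosh (\<beta> * u) * \<bar>cos (x * u)\<bar>"
      unfolding eq using that assms by (simp add: abs_mult)
    also have "\<dots> \<le> 1 / cosh (\<beta> * u) * 1"
      using that assms by (intro mult_mono divide_right_mono) auto
    also have "\<dots> \<le> 2 * exp (- \<beta> * u)" using one_over_cosh_le[of "\<beta> * u"] by simp
    finally show ?thesis .
  qed
  have h: "(\<lambda>u. 2 * exp (- \<beta> * u)) integrable_on {0::real..}"
    using assms by (intro integrable_on_mult_right integrable_on_exp_minus_to_infinity) simp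
  note dc = dominated_convergence[OF has_integral_integrable[OF int] h le conv]
  have "(\<lambda>n. 1 / \<beta> * (\<Sum>k<n. ?a k)) \<longlonglongrightarrow> integral {0..} (\<lambda>u. if u = 0 then 0 else cos (x * u) / cosh (\<beta> * u))"
    using dc(2) by (simp only: integral_unique[OF int])
  moreover have "(\<lambda>n. 1 / \<beta> * (\<Sum>k<n. ?a k)) \<longlonglongrightarrow> 1 / \<beta> * (pi / (2 * cosh (pi * (x / \<beta>) / 2)))"
    using sech_partial_fractions[of "x / \<beta>"] unfolding sums_def by (intro tendsto_intros)
  ultimately have "integral {0..} (\<lambda>u. if u = 0 then 0 else cos (x * u) / cosh (\<beta> * u)) =
      1 / \<beta> * (pi / (2 * cosh (pi * (x / \<beta>) / 2)))"
    by (rule LIMSEQ_unique)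
  with dc(1) have "((\<lambda>u. if u = 0 then 0 else cos (x * u) / cosh (\<beta> * u)) has_integral
      pi / (2 * \<beta> * cosh (pi * x / (2 * \<beta>)))) {0..}"
    by (simp add: has_integral_iff mult_ac)
  then show ?thesis
    by (rule has_integral_spike_finite[of "{0}", rotated 2]) auto
qed

section \<open>Gaussian cosine transforms\<close>

lemma exp_linear_mult_chirp:
  assumes "s \<noteq> 0"
  shows "exp (\<i> * of_real (x * v)) * chirp s x = exp (\<i> * of_real (v\<^sup>2 / (4 * s))) * chirp s (x - v / (2 * s))"
proof -
  have "x * v - s * x\<^sup>2 = v\<^sup>2 / (4 * s) - s * (x - v / (2 * s))\<^sup>2"
    using assms by (simp add: field_simps power2_eq_square)
  then have "\<i> * of_real (x * v) - \<i> * of_real (s * x\<^sup>2) =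
      \<i> * of_real (v\<^sup>2 / (4 * s)) - \<i> * of_real (s * (x - v / (2 * s))\<^sup>2)"
    by (simp only: right_diff_distrib[symmetric] of_real_diff[symmetric])
  then show ?thesis
    by (simp only: chirp_def exp_add[symmetric] diff_conv_add_uminus[symmetric])
qed

definition fresnel_cos :: "real \<Rightarrow> real \<Rightarrow> real \<Rightarrow> complex" where
  "fresnel_cos s v x = exp (\<i> * of_real (v\<^sup>2 / (4 * s))) / 2 * (fresnel s (x - v / (2 * s)) + fresnel s (x + v / (2 * s)))"

lemma fresnel_cos_has_integral:
  assumes "s \<noteq> 0" "R \<ge> 0"
  shows "((\<lambda>x. of_real (cos (x * v)) * chirp s x) has_integral fresnel_cos s v R) {0..R}"
proof -
  have "((\<lambda>x. of_real (cos (x * v)) * chirp s x) has_integral fresnel_cos s v R - fresnel_cos s v 0) {0..R}"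
  proof (rule fundamental_theorem_of_calculus[OF assms(2)])
    fix x
    have "of_real (cos (x * v)) * chirp s x =
        (exp (\<i> * of_real (x * v)) * chirp s x + exp (\<i> * of_real (x * (- v))) * chirp s x) / 2"
      by (simp add: cos_of_real[symmetric] cos_exp_eq algebra_simps)
    also have "\<dots> = exp (\<i> * of_real (v\<^sup>2 / (4 * s))) / 2 *
        (of_real 1 * chirp s (x - v / (2 * s)) + of_real 1 * chirp s (x + v / (2 * s)))"
      unfolding exp_linear_mult_chirp[OF assms(1)] by (simp add: algebra_simps)
    finally have eq: "of_real (cos (x * v)) * chirp s x = exp (\<i> * of_real (v\<^sup>2 / (4 * s))) / 2 *
        (of_real 1 * chirp s (x - v / (2 * s)) + of_real 1 * chirp s (x + v / (2 * s)))" .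
    show "(fresnel_cos s v has_vector_derivative of_real (cos (x * v)) * chirp s x) (at x within {0..R})"
      unfolding fresnel_cos_def [abs_def] eq
      by (intro has_vector_derivative_mult_right has_vector_derivative_add fresnel_chain)
         (auto intro!: derivative_eq_intros)
  qed
  moreover have "fresnel_cos s v 0 = 0" by (simp add: fresnel_cos_def)
  ultimately show ?thesis by simp
qed

lemma fresnel_cos_bounded:
  assumes "s \<noteq> 0"
  obtains C where "\<And>v x. norm (fresnel_cos s v x) \<le> C"
proof -
  obtain C where C: "norm (fresnel s x) \<le> C" for x
    using fresnel_bounded[OF assms] by blast
  have "norm (fresnel_cos s v x) \<le> C" for v x
  proof -
    have "norm (fresnel_cos s v x) = norm (fresnel s (x - v / (2 * s)) + fresnel s (x + v / (2 * s))) / 2"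
      unfolding fresnel_cos_def norm_mult norm_divide norm_exp_i_times by simp
    also have "\<dots> \<le> (C + C) / 2"
      by (intro divide_right_mono norm_triangle_mono C) simp
    finally show ?thesis by simp
  qed
  then show thesis by (rule that)
qed

lemma tendsto_fresnel_cos:
  assumes "s \<noteq> 0"
  shows "(fresnel_cos s v \<longlongrightarrow> exp (\<i> * of_real (v\<^sup>2 / (4 * s))) * fresnel_lim s) at_top"
proof -
  have "((\<lambda>x. fresnel s (x + c)) \<longlongrightarrow> fresnel_lim s) at_top" for c
    by (intro filterlim_compose[OF tendsto_fresnel_lim[OF assms]]) real_asymp
  from this[of "- v / (2 * s)"] this[of "v / (2 * s)"]
  have "(fresnel_cos s v \<longlongrightarrow> exp (\<i> * of_real (v\<^sup>2 / (4 * s))) / 2 * (fresnel_lim s + fresnel_lim s)) at_top"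
    unfolding fresnel_cos_def [abs_def] by (intro tendsto_intros) auto
  then show ?thesis by simp
qed

definition chirp_cos_transform :: "real \<Rightarrow> real \<Rightarrow> real \<Rightarrow> complex" where
  "chirp_cos_transform s w u =
    fresnel_lim s * exp (\<i> * of_real ((w\<^sup>2 + u\<^sup>2) / (4 * s))) * of_real (cos (w * u / (2 * s)))"

lemma continuous_on_chirp_cos_transform:
  assumes "s \<noteq> 0"
  shows "continuous_on A (chirp_cos_transform s w)"
  unfolding chirp_cos_transform_def [abs_def] using assms by (intro continuous_intros) auto

lemma cos_mult_cos_has_integral:
  assumes "s \<noteq> 0" "R \<ge> 0"
  shows "((\<lambda>x. of_real (cos (x * w) * cos (x * u)) * chirp s x) has_integral
    (fresnel_cos s (w - u) R + fresnel_cos s (w + u) R) / 2) {0..R}"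
proof -
  have "((\<lambda>x. (of_real (cos (x * (w - u))) * chirp s x + of_real (cos (x * (w + u))) * chirp s x) / 2) has_integral
    (fresnel_cos s (w - u) R + fresnel_cos s (w + u) R) / 2) {0..R}"
    by (intro has_integral_divide has_integral_add fresnel_cos_has_integral assms)
  moreover have "(of_real (cos (x * (w - u))) * chirp s x + of_real (cos (x * (w + u))) * chirp s x) / 2 =
      of_real (cos (x * w) * cos (x * u)) * chirp s x" for x
    by (simp add: cos_times_cos right_diff_distrib distrib_left distrib_right)
  ultimately show ?thesis by simp
qed

lemma tendsto_chirp_cos_transform:
  assumes "s \<noteq> 0"
  shows "((\<lambda>R. (fresnel_cos s (w - u) R + fresnel_cos s (w + u) R) / 2) \<longlongrightarrow> chirp_cos_transform s w u) at_top"
proof -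
  define q where "q = w * u / (2 * s)"
  have sq: "(w - u)\<^sup>2 / (4 * s) = (w\<^sup>2 + u\<^sup>2) / (4 * s) - q" "(w + u)\<^sup>2 / (4 * s) = (w\<^sup>2 + u\<^sup>2) / (4 * s) + q"
    using assms by (simp_all add: q_def field_simps power2_eq_square)
  have "(exp (\<i> * of_real ((w - u)\<^sup>2 / (4 * s))) * fresnel_lim s + exp (\<i> * of_real ((w + u)\<^sup>2 / (4 * s))) * fresnel_lim s) / 2 =
    chirp_cos_transform s w u"
  proof -
    have E: "exp (\<i> * of_real (a - q)) = exp (\<i> * of_real a) * exp (- (\<i> * of_real q))"
      "exp (\<i> * of_real (a + q)) = exp (\<i> * of_real a) * exp (\<i> * of_real q)" for a
      by (simp_all add: ring_distribs flip: exp_add)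
    have "(x * m * l + x * p * l) / 2 = l * x * ((p + m) / 2)" for x m p l :: complex
      by (simp add: algebra_simps)
    then show ?thesis
      unfolding sq E chirp_cos_transform_def q_def[symmetric] cos_of_real[symmetric] cos_exp_eq .
  qed
  moreover have "((\<lambda>R. (fresnel_cos s (w - u) R + fresnel_cos s (w + u) R) / 2) \<longlongrightarrow>
    (exp (\<i> * of_real ((w - u)\<^sup>2 / (4 * s))) * fresnel_lim s + exp (\<i> * of_real ((w + u)\<^sup>2 / (4 * s))) * fresnel_lim s) / 2) at_top"
    by (intro tendsto_intros tendsto_fresnel_cos assms) simp
  ultimately show ?thesis by simp
qed

text \<open>The double integral over \<open>{0..R} \<times> UNIV\<close> converges absolutely, so Fubini applies; the
  uniform bound on the Fresnel integrals then dominates the limit \<open>R \<rightarrow> \<infinity>\<close>.\<close>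
lemma chirp_cos_parseval:
  fixes g :: "real \<Rightarrow> complex"
  assumes s: "s \<noteq> 0" and g: "integrable lborel g"
  shows "((\<lambda>z. of_real (cos (z * w)) * chirp s z * (LINT u|lborel. g u * of_real (cos (z * u)))) has_integral
    (LINT u|lborel. g u * chirp_cos_transform s w u)) {0..}"
proof (rule has_integral_atLeastI)
  let ?T = "\<lambda>R u. (fresnel_cos s (w - u) R + fresnel_cos s (w + u) R) / 2"
  have [measurable]: "g \<in> borel_measurable lborel" using g by simp
  have [measurable]: "chirp s \<in> borel_measurable borel"
    by (intro borel_measurable_continuous_onI continuous_intros)
  have T_meas [measurable]: "?T R \<in> borel_measurable borel" for R
    unfolding fresnel_cos_def by (intro borel_measurable_continuous_onI continuous_intros) (use s in auto)
  show "((\<lambda>z. of_real (cos (z * w)) * chirp s z * (LINT u|lborel. g u * of_real (cos (z * u)))) has_integral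
      (LINT u|lborel. g u * ?T R u)) {0..R}" if "R \<ge> 0" for R
  proof -
    let ?f = "\<lambda>(z, u). indicator {0..R} z *\<^sub>R (of_real (cos (z * w)) * chirp s z * (g u * of_real (cos (z * u))))"
    have "integrable (lborel \<Otimes>\<^sub>M lborel) (\<lambda>(z::real, u). indicator {0..R} z *\<^sub>R norm (g u))"
    proof (rule lborel_pair.Fubini_integrable)
      have "integrable lborel (\<lambda>z::real. indicator {0..R} z *\<^sub>R (LINT u|lborel. norm (g u)))"
        by (intro integrable_scaleR_left integrable_real_indicator) (auto simp: emeasure_lborel_Icc_eq)
      then show "integrable lborel (\<lambda>z. LINT u|lborel. norm (case (z::real, u) of (z, u) \<Rightarrow> indicator {0..R} z *\<^sub>R norm (g u)))"
        by (simp add: abs_mult)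
      show "AE z in lborel. integrable lborel (\<lambda>u. case (z::real, u) of (z, u) \<Rightarrow> indicator {0..R} z *\<^sub>R norm (g u))"
        using g by auto
    qed measurable
    then have f: "integrable (lborel \<Otimes>\<^sub>M lborel) ?f"
    proof (rule Bochner_Integration.integrable_bound)
      show "?f \<in> borel_measurable (lborel \<Otimes>\<^sub>M lborel)" by measurable
      have "cmod (of_real (cos (z * w)) * chirp s z * (g u * of_real (cos (z * u)))) \<le> 1 * 1 * (cmod (g u) * 1)" for z u
        unfolding norm_mult norm_chirp norm_of_real by (intro mult_mono) auto
      then show "AE p in lborel \<Otimes>\<^sub>M lborel. norm (?f p) \<le> norm (case p of (z, u) \<Rightarrow> indicator {0..R} z *\<^sub>R norm (g u))"
        by (intro AE_I2) (auto simp: indicator_def)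
    qed
    have 1: "(LINT u|lborel. ?f (z, u)) =
      indicator {0..R} z *\<^sub>R (of_real (cos (z * w)) * chirp s z * (LINT u|lborel. g u * of_real (cos (z * u))))" for z
      by simp
    have 2: "(LINT z|lborel. ?f (z, u)) = g u * ?T R u" for u
    proof -
      let ?h = "\<lambda>z. of_real (cos (z * w) * cos (z * u)) * chirp s z"
      have "set_integrable lborel {0..R} ?h"
        by (intro borel_integrable_atLeastAtMost' continuous_intros)
      from set_borel_integral_eq_integral(2)[OF this]
      have "(LINT z:{0..R}|lborel. ?h z) = ?T R u"
        using integral_unique[OF cos_mult_cos_has_integral[OF s \<open>R \<ge> 0\<close>]] by simp
      moreover have "(LINT z|lborel. ?f (z, u)) = (LINT z|lborel. g u * (indicator {0..R} z *\<^sub>R ?h z))"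
        by (simp add: mult_ac)
      ultimately show ?thesis
        by (simp only: integral_mult_right_zero set_lebesgue_integral_def)
    qed
    have int: "set_integrable lborel {0..R} (\<lambda>z. of_real (cos (z * w)) * chirp s z * (LINT u|lborel. g u * of_real (cos (z * u))))"
      using lborel_pair.integrable_fst'[OF f] unfolding 1 set_integrable_def .
    moreover have "(LINT z:{0..R}|lborel. of_real (cos (z * w)) * chirp s z * (LINT u|lborel. g u * of_real (cos (z * u)))) =
       (LINT u|lborel. g u * ?T R u)"
      using lborel_pair.Fubini_integral[of "\<lambda>z u. ?f (z, u)"] f unfolding 1 2 set_lebesgue_integral_def
      by (simp add: case_prod_unfold)
    ultimately show ?thesis
      using set_borel_integral_eq_integral[OF int] by (simp only: has_integral_iff simp_thms)
  qed
  obtain C where C: "norm (fresnel_cos s v x) \<le> C" for v x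
    using fresnel_cos_bounded[OF s] by blast
  show "((\<lambda>R. LINT u|lborel. g u * ?T R u) \<longlongrightarrow> (LINT u|lborel. g u * chirp_cos_transform s w u)) at_top"
  proof (rule integral_dominated_convergence_at_top)
    show "integrable lborel (\<lambda>u. norm (g u) * C)" using g by auto
    show "AE u in lborel. ((\<lambda>R. g u * ?T R u) \<longlongrightarrow> g u * chirp_cos_transform s w u) at_top"
      by (intro AE_I2 tendsto_intros tendsto_chirp_cos_transform s)
    have "norm (?T R u) \<le> C" for R u
    proof -
      have "norm (?T R u) = norm (fresnel_cos s (w - u) R + fresnel_cos s (w + u) R) / 2" by simp
      also have "\<dots> \<le> (C + C) / 2" by (intro divide_right_mono norm_triangle_mono C) simp
      finally show ?thesis by simp
    qed
    then show "\<forall>\<^sub>F R in at_top. AE u in lborel. norm (g u * ?T R u) \<le> norm (g u) * C"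
      by (intro always_eventually allI AE_I2) (simp only: norm_mult mult_left_mono norm_ge_zero)
    show "(\<lambda>u. g u * ?T R u) \<in> borel_measurable lborel" for R by measurable
    have [measurable]: "chirp_cos_transform s w \<in> borel_measurable borel"
      by (intro borel_measurable_continuous_onI continuous_on_chirp_cos_transform s)
    show "(\<lambda>u. g u * chirp_cos_transform s w u) \<in> borel_measurable lborel" by measurable
  qed
qed

section \<open>The double integral\<close>

lemma integrable_one_over_cosh:
  assumes "\<beta> > 0"
  shows "integrable lborel (\<lambda>u. indicator {0..} u / cosh (\<beta> * u) :: real)"
proof -
  have "(\<lambda>u. 1 / cosh (\<beta> * u)) integrable_on {0..}"
    using sech_cos_transform[OF assms, of 0] by (auto simp: integrable_on_def)
  then have "(\<lambda>u. 1 / cosh (\<beta> * u)) absolutely_integrable_on {0..}"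
    by (rule nonnegative_absolutely_integrable_1) simp
  then have "integrable lebesgue (\<lambda>u. indicator {0..} u / cosh (\<beta> * u) :: real)"
    by (simp add: set_integrable_def)
  moreover have "(\<lambda>u. 1 / cosh (\<beta> * u)) \<in> borel_measurable borel"
    by (intro borel_measurable_continuous_onI continuous_intros) auto
  then have "(\<lambda>u. indicator {0..} u * (1 / cosh (\<beta> * u)) :: real) \<in> borel_measurable lborel"
    by measurable
  ultimately show ?thesis by (simp add: integrable_completion)
qed

lemma integrable_bounded_over_cosh:
  fixes f :: "real \<Rightarrow> complex"
  assumes "\<beta> > 0" and "continuous_on UNIV f" and "\<And>u. norm (f u) \<le> C"
  shows "integrable lborel (\<lambda>u. of_real (indicator {0..} u / cosh (\<beta> * u)) * f u)"
proof (rule Bochner_Integration.integrable_bound)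
  show "integrable lborel (\<lambda>u. indicator {0..} u / cosh (\<beta> * u) * C)"
    by (intro integrable_mult_left integrable_one_over_cosh assms)
  have [measurable]: "f \<in> borel_measurable borel"
    using assms(2) by (rule borel_measurable_continuous_onI)
  have [measurable]: "(\<lambda>u. indicator {0..} u / cosh (\<beta> * u) :: real) \<in> borel_measurable borel"
    using integrable_one_over_cosh[OF assms(1)] by simp
  show "(\<lambda>u. of_real (indicator {0..} u / cosh (\<beta> * u)) * f u) \<in> borel_measurable lborel"
    by measurable
  have "norm (of_real (indicator {0..} u / cosh (\<beta> * u)) * f u) \<le> norm (indicator {0..} u / cosh (\<beta> * u) * C)" for u
    using assms(3)[of u] order_trans[OF norm_ge_zero assms(3)]
    unfolding norm_mult norm_of_real by (intro mult_mono) auto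
  then show "AE u in lborel. norm (of_real (indicator {0..} u / cosh (\<beta> * u)) * f u) \<le>
      norm (indicator {0..} u / cosh (\<beta> * u) * C)" by (rule AE_I2)
qed

lemma integral_bounded_over_cosh:
  fixes f :: "real \<Rightarrow> complex"
  assumes "\<beta> > 0" and "continuous_on UNIV f" and "\<And>u. norm (f u) \<le> C"
  shows "((\<lambda>u. f u / of_real (cosh (\<beta> * u))) has_integral
    (LINT u|lborel. of_real (indicator {0..} u / cosh (\<beta> * u)) * f u)) {0..}"
proof -
  have eq: "of_real (indicator {0..} u / cosh (\<beta> * u)) * f u = indicator {0..} u *\<^sub>R (f u / of_real (cosh (\<beta> * u)))" for u
    by (simp add: indicator_def)
  have "set_integrable lborel {0..} (\<lambda>u. f u / of_real (cosh (\<beta> * u)))"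
    using integrable_bounded_over_cosh[OF assms] unfolding eq set_integrable_def .
  from set_borel_integral_eq_integral[OF this] show ?thesis
    unfolding eq set_lebesgue_integral_def by (simp only: has_integral_iff simp_thms)
qed

lemma cosh_kernel_eq:
  assumes "\<beta> > 0"
  shows "cosh_kernel \<beta> z1 z2 =
    (pi / (2 * \<beta> * cosh (pi * (z1 - z2) / (2 * \<beta>))) + pi / (2 * \<beta> * cosh (pi * (z1 + z2) / (2 * \<beta>)))) / 2"
proof -
  define p q where "p = pi * z1 / (2 * \<beta>)" and "q = pi * z2 / (2 * \<beta>)"
  have "cosh ((p + q) + (p - q)) + cosh ((p + q) - (p - q)) = 2 * (cosh (p + q) * cosh (p - q))"
    unfolding cosh_add[of "p + q" "p - q"] cosh_diff[of "p + q" "p - q"] by simp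
  then have den: "cosh (2 * p) + cosh (2 * q) = 2 * (cosh (p + q) * cosh (p - q))"
    by simp
  have num: "cosh p * cosh q = (cosh (p + q) + cosh (p - q)) / 2"
    by (simp add: cosh_add cosh_diff)
  have "(a + b) / 2 / (2 * (a * b)) = (1 / b + 1 / a) / 4" if "a \<noteq> 0" "b \<noteq> 0" for a b :: real
    using that by (simp add: field_simps)
  from this[of "cosh (p + q)" "cosh (p - q)"]
  have "cosh p * cosh q / (cosh (2 * p) + cosh (2 * q)) = (1 / cosh (p - q) + 1 / cosh (p + q)) / 4"
    unfolding den num by simp
  moreover have "pi * z1 / \<beta> = 2 * p" "pi * z2 / \<beta> = 2 * q"
    by (simp_all add: p_def q_def)
  moreover have "pi * (z1 - z2) / (2 * \<beta>) = p - q" "pi * (z1 + z2) / (2 * \<beta>) = p + q"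
    by (simp_all only: p_def q_def distrib_left right_diff_distrib add_divide_distrib diff_divide_distrib)
  moreover have "pi / \<beta> * ((1 / a + 1 / b) / 4) = (pi / (2 * \<beta> * a) + pi / (2 * \<beta> * b)) / 2" for a b
    by (simp add: distrib_left add_divide_distrib)
  ultimately show ?thesis
    unfolding cosh_kernel_def p_def[symmetric] q_def[symmetric] by (simp only:)
qed

lemma cosh_kernel_has_integral:
  assumes "\<beta> > 0"
  shows "((\<lambda>u. cos (z2 * u) * cos (z1 * u) / cosh (\<beta> * u)) has_integral cosh_kernel \<beta> z1 z2) {0..}"
proof -
  have "((\<lambda>u. (cos ((z1 - z2) * u) / cosh (\<beta> * u) + cos ((z1 + z2) * u) / cosh (\<beta> * u)) / 2) has_integral
      cosh_kernel \<beta> z1 z2) {0..}"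
    unfolding cosh_kernel_eq[OF assms]
    by (intro has_integral_divide has_integral_add sech_cos_transform assms)
  moreover have "(cos ((z1 - z2) * u) / cosh (\<beta> * u) + cos ((z1 + z2) * u) / cosh (\<beta> * u)) / 2 =
      cos (z2 * u) * cos (z1 * u) / cosh (\<beta> * u)" for u
  proof -
    have "cos (z1 * u) * cos (z2 * u) = (cos ((z1 - z2) * u) + cos ((z1 + z2) * u)) / 2"
      unfolding cos_times_cos left_diff_distrib distrib_right ..
    then have "cos (z2 * u) * cos (z1 * u) = (cos ((z1 - z2) * u) + cos ((z1 + z2) * u)) / 2"
      by (simp only: mult.commute)
    then show ?thesis by (simp add: add_divide_distrib)
  qed
  ultimately show ?thesis by simp
qed

lemma cosh_kernel_eq_LINT:
  assumes "\<beta> > 0"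
  shows "(LINT u|lborel. of_real (indicator {0..} u / cosh (\<beta> * u)) * of_real (cos (z2 * u)) * of_real (cos (z1 * u))) =
    (of_real (cosh_kernel \<beta> z1 z2) :: complex)"
proof -
  have "norm (of_real (cos (z2 * u)) * of_real (cos (z1 * u)) :: complex) \<le> 1 * 1" for u
    unfolding norm_mult by (intro mult_mono) auto
  then have "((\<lambda>u. of_real (cos (z2 * u)) * of_real (cos (z1 * u)) / of_real (cosh (\<beta> * u)) :: complex) has_integral
    (LINT u|lborel. of_real (indicator {0..} u / cosh (\<beta> * u)) * (of_real (cos (z2 * u)) * of_real (cos (z1 * u))))) {0..}"
    by (intro integral_bounded_over_cosh assms continuous_intros)
  moreover have "((\<lambda>u. of_real (cos (z2 * u)) * of_real (cos (z1 * u)) / of_real (cosh (\<beta> * u)) :: complex) has_integral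
    of_real (cosh_kernel \<beta> z1 z2)) {0..}"
    using has_integral_of_real[OF cosh_kernel_has_integral[OF assms, of z2 z1], where 'b = complex] by simp
  ultimately show ?thesis
    unfolding mult.assoc by (rule has_integral_unique)
qed

lemma norm_chirp_cos_transform_le: "norm (chirp_cos_transform s w u) \<le> norm (fresnel_lim s)"
proof -
  have "norm (chirp_cos_transform s w u) = norm (fresnel_lim s) * \<bar>cos (w * u / (2 * s))\<bar>"
    unfolding chirp_cos_transform_def norm_mult norm_exp_i_times norm_of_real by simp
  also have "\<dots> \<le> norm (fresnel_lim s) * 1"
    by (intro mult_left_mono) auto
  finally show ?thesis by simp
qed

lemma fresnel_lim_mult:
  assumes "k \<noteq> 0" "m1 > 0" "m2 > 0"
  shows "fresnel_lim (k / (2 * m1)) * fresnel_lim (k / (2 * m2)) = of_real (pi * sqrt (m1 * m2) / k) / (2 * \<i>)"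
proof -
  define c where "c = sqrt (m1 / m2)"
  have c: "c > 0" using assms by (simp add: c_def)
  have "k / (2 * m1) * c\<^sup>2 = k / (2 * m2)"
    using assms by (simp add: c_def)
  then have "fresnel_lim (k / (2 * m1)) * fresnel_lim (k / (2 * m2)) = of_real c * (fresnel_lim (k / (2 * m2)))\<^sup>2"
    using fresnel_lim_scale[of "k / (2 * m1)" c] assms c by (simp add: power2_eq_square)
  also have "\<dots> = of_real c * (of_real pi / (4 * \<i> * of_real (k / (2 * m2))))"
    using assms by (subst fresnel_lim_square) auto
  also have "\<dots> = of_real (pi * (c * m2) / k) / (2 * \<i>)"
    using assms by (simp add: field_simps)
  also have "c * m2 = sqrt (m1 * m2)"
    using assms by (simp add: c_def real_sqrt_divide real_sqrt_mult real_div_sqrt)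
      (metis mult.assoc nonzero_eq_divide_eq order_less_le real_sqrt_gt_zero real_sqrt_mult_self abs_of_pos)
  finally show ?thesis .
qed

lemma chirp_cos_transform_mult:
  assumes "k \<noteq> 0" "m1 > 0" "m2 > 0"
  shows "chirp_cos_transform (k / (2 * m1)) w1 u * chirp_cos_transform (k / (2 * m2)) w2 u =
    of_real (pi * sqrt (m1 * m2) / k) / (4 * \<i>) * gauss_phase w1 w2 (k / (2 * m1)) (k / (2 * m2)) *
    (exp (\<i> * of_real (u\<^sup>2 * (m1 + m2) / (2 * k))) *
      (cos (of_real (w1 * m1 + w2 * m2) * of_real u / of_real k) + cos (of_real (w1 * m1 - w2 * m2) * of_real u / of_real k)))"
proof -
  define s1 s2 where "s1 = k / (2 * m1)" and "s2 = k / (2 * m2)"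
  have L: "fresnel_lim s1 * fresnel_lim s2 = of_real (pi * sqrt (m1 * m2) / k) / (2 * \<i>)"
    unfolding s1_def s2_def by (rule fresnel_lim_mult[OF assms])
  have expi: "exp (\<i> * of_real a) * exp (\<i> * of_real b) = exp (\<i> * of_real (a + b))" for a b :: real
    by (simp add: distrib_left exp_add)
  have "of_real a / (4 * \<i> * of_real s) = - (\<i> * of_real (a / (4 * s)))" for a s :: real
    by (cases "s = 0") (simp_all add: field_simps)
  from this[of "w1\<^sup>2" s1] this[of "w2\<^sup>2" s2]
  have gp: "gauss_phase w1 w2 s1 s2 = exp (\<i> * of_real (w1\<^sup>2 / (4 * s1) + w2\<^sup>2 / (4 * s2)))"
    by (simp add: gauss_phase_def distrib_left add.commute)
  have "u\<^sup>2 / (4 * s1) = u\<^sup>2 * m1 / (2 * k)" "u\<^sup>2 / (4 * s2) = u\<^sup>2 * m2 / (2 * k)"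
    by (simp_all add: s1_def s2_def)
  then have sum: "(w1\<^sup>2 + u\<^sup>2) / (4 * s1) + (w2\<^sup>2 + u\<^sup>2) / (4 * s2) =
      (w1\<^sup>2 / (4 * s1) + w2\<^sup>2 / (4 * s2)) + u\<^sup>2 * (m1 + m2) / (2 * k)"
    by (simp only: distrib_left add_divide_distrib add_ac)
  have ph: "exp (\<i> * of_real ((w1\<^sup>2 + u\<^sup>2) / (4 * s1))) * exp (\<i> * of_real ((w2\<^sup>2 + u\<^sup>2) / (4 * s2))) =
    gauss_phase w1 w2 s1 s2 * exp (\<i> * of_real (u\<^sup>2 * (m1 + m2) / (2 * k)))"
    unfolding gp expi sum ..
  have arg: "w1 * u / (2 * s1) + w2 * u / (2 * s2) = (w1 * m1 + w2 * m2) * u / k"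
    "w1 * u / (2 * s1) - w2 * u / (2 * s2) = (w1 * m1 - w2 * m2) * u / k"
  proof -
    have "w1 * u / (2 * s1) = w1 * m1 * u / k" "w2 * u / (2 * s2) = w2 * m2 * u / k"
      by (simp_all add: s1_def s2_def mult_ac)
    then show "w1 * u / (2 * s1) + w2 * u / (2 * s2) = (w1 * m1 + w2 * m2) * u / k"
      "w1 * u / (2 * s1) - w2 * u / (2 * s2) = (w1 * m1 - w2 * m2) * u / k"
      by (simp_all only: distrib_right left_diff_distrib add_divide_distrib diff_divide_distrib)
  qed
  have cs: "of_real (cos (w1 * u / (2 * s1))) * of_real (cos (w2 * u / (2 * s2))) =
    (cos (of_real (w1 * m1 + w2 * m2) * of_real u / of_real k) +
     cos (of_real (w1 * m1 - w2 * m2) * of_real u / of_real k) :: complex) / 2"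
    unfolding of_real_mult[symmetric] of_real_divide[symmetric] cos_of_real of_real_add[symmetric] cos_times_cos arg
    by (simp add: add.commute)
  have "chirp_cos_transform s1 w1 u * chirp_cos_transform s2 w2 u = (fresnel_lim s1 * fresnel_lim s2) *
      (exp (\<i> * of_real ((w1\<^sup>2 + u\<^sup>2) / (4 * s1))) * exp (\<i> * of_real ((w2\<^sup>2 + u\<^sup>2) / (4 * s2)))) *
      (of_real (cos (w1 * u / (2 * s1))) * of_real (cos (w2 * u / (2 * s2))))"
    by (simp only: chirp_cos_transform_def mult_ac)
  moreover have "a / (2 * \<i>) * (b * c) * (d / 2) = a / (4 * \<i>) * b * (c * d)" for a b c d :: complex
    by simp
  ultimately show ?thesis
    unfolding L ph cs unfolding s1_def s2_def by (rule trans)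
qed

theorem theorem4p1:
  fixes hbar t m1 m2 w1 w2 \<beta> :: real
  assumes "hbar > 0" and "t \<noteq> 0" and "m1 > 0" and "m2 > 0" and "\<beta> > 0"
  shows "(\<forall>z2\<ge>0. (\<lambda>z1. schroedinger_integrand hbar t m1 m2 w1 w2 \<beta> z1 z2) integrable_on {0..}) \<and>
    ((\<lambda>z2. integral {0..} (\<lambda>z1. schroedinger_integrand hbar t m1 m2 w1 w2 \<beta> z1 z2)) has_integral
      (1 / \<i>) * (I_beta hbar t m1 m2 w1 w2 \<beta> (of_real (w1 * m1 + w2 * m2)) +
                 I_beta hbar t m1 m2 w1 w2 \<beta> (of_real (w1 * m1 - w2 * m2)))) {0..}"
proof -
  define k where "k = hbar * t"
  have k: "k \<noteq> 0" using assms by (simp add: k_def)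
  define s1 s2 where "s1 = k / (2 * m1)" and "s2 = k / (2 * m2)"
  have nz: "s1 \<noteq> 0" "s2 \<noteq> 0" using assms k by (auto simp: s1_def s2_def)
  let ?h = "\<lambda>u. of_real (indicator {0..} u / cosh (\<beta> * u)) :: complex"
  let ?G1 = "chirp_cos_transform s1 w1" and ?G2 = "chirp_cos_transform s2 w2"

  have integrand: "schroedinger_integrand hbar t m1 m2 w1 w2 \<beta> z1 z2 =
      of_real (cos (z2 * w2)) * chirp s2 z2 * (of_real (cos (z1 * w1)) * chirp s1 z1 * of_real (cosh_kernel \<beta> z1 z2))" for z1 z2
  proof -
    have phase: "hbar * z1\<^sup>2 * t / (2 * m1) = s1 * z1\<^sup>2" "hbar * z2\<^sup>2 * t / (2 * m2) = s2 * z2\<^sup>2"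
      by (simp_all add: s1_def s2_def k_def)
    have exp: "exp (- \<i> * a - \<i> * b) = exp (- (\<i> * a)) * exp (- (\<i> * b))" for a b :: complex
      by (simp flip: exp_add)
    show ?thesis
      unfolding schroedinger_integrand_def chirp_def phase exp by (simp only: of_real_mult mult_ac)
  qed

  have inner: "((\<lambda>z1. schroedinger_integrand hbar t m1 m2 w1 w2 \<beta> z1 z2) has_integral
    of_real (cos (z2 * w2)) * chirp s2 z2 * (LINT u|lborel. ?h u * ?G1 u * of_real (cos (z2 * u)))) {0..}" for z2
  proof -
    have "integrable lborel (\<lambda>u. ?h u * of_real (cos (z2 * u)))"
      by (intro integrable_bounded_over_cosh[where C = 1] assms continuous_intros) simp
    from has_integral_mult_right[OF chirp_cos_parseval[OF nz(1) this, of w1], of "of_real (cos (z2 * w2)) * chirp s2 z2"]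
    show ?thesis
      unfolding cosh_kernel_eq_LINT[OF assms(5)] integrand by (simp only: mult_ac)
  qed

  have "integrable lborel (\<lambda>u. ?h u * ?G1 u)"
    by (intro integrable_bounded_over_cosh[where C = "norm (fresnel_lim s1)"] assms continuous_on_chirp_cos_transform nz norm_chirp_cos_transform_le)
  from chirp_cos_parseval[OF nz(2) this, of w2]
  have outer: "((\<lambda>z2. integral {0..} (\<lambda>z1. schroedinger_integrand hbar t m1 m2 w1 w2 \<beta> z1 z2)) has_integral
    (LINT u|lborel. ?h u * ?G1 u * ?G2 u)) {0..}"
    unfolding integral_unique[OF inner] .

  define c where "c = of_real (pi * sqrt (m1 * m2) / k) / (4 * \<i>) * gauss_phase w1 w2 s1 s2"
  define J where "J x u = exp (\<i> * of_real (u\<^sup>2 * (m1 + m2) / (2 * k))) * cos (of_real x * of_real u / of_real k)" for x u :: real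
  have J_norm: "norm (J x u) \<le> 1" for x u
    unfolding J_def norm_mult norm_exp_i_times of_real_mult[symmetric] of_real_divide[symmetric] cos_of_real norm_of_real
    by simp
  have J_cont: "continuous_on UNIV (J x)" for x
    unfolding J_def [abs_def] using k by (intro continuous_intros) auto
  have J_int: "integrable lborel (\<lambda>u. ?h u * J x u)" for x
    by (rule integrable_bounded_over_cosh[OF assms(5) J_cont J_norm])
  have I: "1 / \<i> * I_beta hbar t m1 m2 w1 w2 \<beta> (of_real x) = c * (LINT u|lborel. ?h u * J x u)" for x
  proof -
    have "1 / \<i> * I_beta hbar t m1 m2 w1 w2 \<beta> (of_real x) = c * integral {0..} (\<lambda>u. J x u / of_real (cosh (\<beta> * u)))"
    proof -
      have "exp (\<i> * of_real (z\<^sup>2 * (m1 + m2) / (2 * hbar * t))) *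
          (cos (of_real x * of_real z / of_real (t * hbar)) / of_real (cosh (\<beta> * z))) =
        J x z / of_real (cosh (\<beta> * z))" for z
        by (simp add: J_def k_def mult.commute mult.left_commute)
      moreover have "1 / \<i> * (1 / 2\<^sup>2 * a * b * d) = a / (4 * \<i>) * b * d" for a b d :: complex
        by simp
      ultimately show ?thesis
        by (simp only: I_beta_def c_def s1_def s2_def k_def)
    qed
    then show ?thesis
      using integral_unique[OF integral_bounded_over_cosh[OF assms(5) J_cont J_norm]] by simp
  qed
  have "(LINT u|lborel. ?h u * ?G1 u * ?G2 u) =
      (LINT u|lborel. c * (?h u * J (w1 * m1 + w2 * m2) u) + c * (?h u * J (w1 * m1 - w2 * m2) u))"
  proof (rule Bochner_Integration.integral_cong[OF refl])
    fix u
    have "?G1 u * ?G2 u = c * (J (w1 * m1 + w2 * m2) u + J (w1 * m1 - w2 * m2) u)"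
      unfolding s1_def s2_def c_def J_def chirp_cos_transform_mult[OF k assms(3,4)] by (simp only: distrib_left)
    then show "?h u * ?G1 u * ?G2 u = c * (?h u * J (w1 * m1 + w2 * m2) u) + c * (?h u * J (w1 * m1 - w2 * m2) u)"
      by (simp only: mult.assoc) (simp only: ring_distribs mult_ac)
  qed
  also have "\<dots> = c * (LINT u|lborel. ?h u * J (w1 * m1 + w2 * m2) u) + c * (LINT u|lborel. ?h u * J (w1 * m1 - w2 * m2) u)"
    by (simp only: Bochner_Integration.integral_add integrable_mult_right J_int integral_mult_right_zero)
  also have "\<dots> = (1 / \<i>) * (I_beta hbar t m1 m2 w1 w2 \<beta> (of_real (w1 * m1 + w2 * m2)) +
                 I_beta hbar t m1 m2 w1 w2 \<beta> (of_real (w1 * m1 - w2 * m2)))"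
    by (simp only: I[symmetric] distrib_left)
  finally show ?thesis
    using inner outer by (auto simp: integrable_on_def)
qed

end
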